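(* Let $R$ be an $\mathbb{N}^n$-graded ring of characteristic $p>0$, $I$ a homogeneous ideal of $R$, and $s\geq 1$ a real number. If $x\in I^{\{s\}}\setminus I^*$ is a homogeneous element, then $\deg x\geq s\delta$, where $\delta=(\delta_1,\ldots,\delta_n)\in\mathbb{N}^n$ and $\delta_i=\min\{d_i\mid \deg f=(d_1,\ldots,d_n) \text{ for some homogeneous } 0\neq f\in I\}$.
   Context: All rings are commutative and noetherian; inequalities between vectors in $\mathbb{R}^n$ are componentwise. $R^\circ$ denotes the set of elements of $R$ lying in no minimal prime of $R$. The letter $q$ denotes positive integer powers of $p$, and $q\gg 0$ means all sufficiently large such powers. $I^{[q]}=(f^q\mid f\in I)$ is the $q$th Frobenius power of $I$. The tight closure $I^*$ is the set of $x\in R$ for which there is $c\in R^\circ$ with $cx^q\in I^{[q]}$ for all $q\gg 0$. For a real number $s\geq 1$, $I^{(s,q)}=I^{\lceil sq\rceil}+I^{[q]}$, and the weak $s$-closure $I^{\{s\}}$ is the ideal of all $x\in R$ for which there exists $c\in R^\circ$ such that $cx^q\in I^{(s,q)}$ for all $q\gg 0$. *)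

theory Defs
  imports "HOL-Algebra.Algebra" "HOL-Analysis.Finite_Cartesian_Product"
begin

text \<open>The order of \<open>\<one>\<close> in the additive group; it is 0 if that order is infinite.\<close>

definition ring_char :: "('a, 'm) ring_scheme \<Rightarrow> nat" where
  "ring_char R = group.ord (add_monoid R) \<one>\<^bsub>R\<^esub>"

text \<open>
  Multidegrees are vectors in \<open>nat ^ 'n\<close>, so that \<open>CARD('n)\<close> is the number of gradings.
  The set \<open>A d\<close> is the homogeneous component of degree \<open>d\<close>; it contains zero, so
  \<open>x \<in> A d\<close> means \<open>deg x = d\<close> precisely when \<open>x \<noteq> \<zero>\<close>.
\<close>

locale multigraded_ring = cring R for R (structure) +
  fixes A :: "nat ^ ('n::finite) \<Rightarrow> 'a set"
  assumes component_subgroup: "additive_subgroup (A d) R"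
    and component_mult: "\<lbrakk> x \<in> A d; y \<in> A e \<rbrakk> \<Longrightarrow> x \<otimes> y \<in> A (d + e)"
    and direct_sum: "r \<in> carrier R \<Longrightarrow>
      \<exists>!g. (\<forall>d. g d \<in> A d) \<and> finite {d. g d \<noteq> \<zero>} \<and> r = (\<Oplus>d\<in>{d. g d \<noteq> \<zero>}. g d)"

definition homogeneous_ideal ::
    "('a, 'm) ring_scheme \<Rightarrow> (nat ^ 'n::finite \<Rightarrow> 'a set) \<Rightarrow> 'a set \<Rightarrow> bool" where
  "homogeneous_ideal R A I \<longleftrightarrow> ideal I R \<and> (\<exists>S \<subseteq> (\<Union>d. A d). I = genideal R S)"

definition minimal_prime :: "('a, 'm) ring_scheme \<Rightarrow> 'a set \<Rightarrow> bool" where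
  "minimal_prime R P \<longleftrightarrow> primeideal P R \<and> (\<forall>Q. primeideal Q R \<and> Q \<subseteq> P \<longrightarrow> Q = P)"

definition off_minimal_primes :: "('a, 'm) ring_scheme \<Rightarrow> 'a set" where
  "off_minimal_primes R = {c \<in> carrier R. \<forall>P. minimal_prime R P \<longrightarrow> c \<notin> P}"

definition frobenius_power :: "('a, 'm) ring_scheme \<Rightarrow> 'a set \<Rightarrow> nat \<Rightarrow> 'a set" where
  "frobenius_power R I q = genideal R ((\<lambda>f. f [^]\<^bsub>R\<^esub> q) ` I)"

text \<open>Ordinary powers of ideals are powers in the monoid \<open>ideals_set R\<close> of ideals.\<close>

definition mixed_power :: "('a, 'm) ring_scheme \<Rightarrow> 'a set \<Rightarrow> real \<Rightarrow> nat \<Rightarrow> 'a set" where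
  "mixed_power R I s q =
     (I [^]\<^bsub>ideals_set R\<^esub> nat \<lceil>s * real q\<rceil>) <+>\<^bsub>R\<^esub> frobenius_power R I q"

text \<open>Here \<open>q = p ^ e\<close> with \<open>p\<close> the characteristic, and \<open>q \<ggreater> 0\<close> is expressed as \<open>e\<close> being large.\<close>

definition tight_closure :: "('a, 'm) ring_scheme \<Rightarrow> 'a set \<Rightarrow> 'a set" where
  "tight_closure R I = {x \<in> carrier R. \<exists>c \<in> off_minimal_primes R.
     \<forall>\<^sub>F e in sequentially. let q = ring_char R ^ e in
       c \<otimes>\<^bsub>R\<^esub> x [^]\<^bsub>R\<^esub> q \<in> frobenius_power R I q}"

definition weak_closure :: "('a, 'm) ring_scheme \<Rightarrow> real \<Rightarrow> 'a set \<Rightarrow> 'a set" where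
  "weak_closure R s I = {x \<in> carrier R. \<exists>c \<in> off_minimal_primes R.
     \<forall>\<^sub>F e in sequentially. let q = ring_char R ^ e in
       c \<otimes>\<^bsub>R\<^esub> x [^]\<^bsub>R\<^esub> q \<in> mixed_power R I s q}"

text \<open>The componentwise minimum over a possibly infinite set of degrees; unspecified if \<open>I\<close>
  contains no nonzero homogeneous element.\<close>

definition min_degree ::
    "('a, 'm) ring_scheme \<Rightarrow> (nat ^ 'n::finite \<Rightarrow> 'a set) \<Rightarrow> 'a set \<Rightarrow> nat ^ 'n" where
  "min_degree R A I =
     (\<chi> i. LEAST k. \<exists>d f. f \<in> I \<and> f \<noteq> \<zero>\<^bsub>R\<^esub> \<and> f \<in> A d \<and> k = d $ i)"

end

theory Submission
  imports Defs
begin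

text \<open>
  Suppose that \<open>d $ i < s * \<delta> $ i\<close> for some coordinate \<open>i\<close>, where \<open>x\<close> has degree \<open>d\<close> and \<open>\<delta>\<close>
  is the minimal degree of \<open>I\<close>, and let \<open>c \<otimes> x [^] q\<close> lie in the mixed power of \<open>I\<close> for all
  large \<open>q\<close>. Write \<open>c \<otimes> x [^] q = u \<oplus> v\<close> with \<open>u\<close> in the \<open>\<lceil>s q\<rceil>\<close>-th power of \<open>I\<close> and \<open>v\<close> in the
  Frobenius power. The \<open>i\<close>-th degrees occurring on the left are at most \<open>D + q * d $ i\<close>, where
  the constant \<open>D\<close> depends only on \<open>c\<close>, whereas those occurring in \<open>u\<close> are at least
  \<open>s * q * \<delta> $ i\<close>. For large \<open>q\<close> the first bound lies strictly below the second, so each homogeneous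
  component of \<open>c \<otimes> x [^] q\<close> is either zero or equal to a component of \<open>v\<close>. The Frobenius power
  of a homogeneous ideal is homogeneous, hence contains these components, and with them
  \<open>c \<otimes> x [^] q\<close>. Thus the same multiplier \<open>c\<close> shows that \<open>x\<close> is in the tight closure; it need
  not be replaced by a homogeneous one.

  The degree estimates and the homogeneity statements are all instances of one construction,
  \<open>graded_span B\<close>, the set of elements whose component in each degree \<open>d\<close> lies in a prescribed
  subgroup \<open>B d\<close>, and of its compatibility with products, \<open>graded_span_mult\<close>. The characteristic
  enters through the homogeneity of the Frobenius power
  (\<open>frobenius_power_subset_graded_span\<close>), which rests on the additivity of \<open>y \<mapsto> y [^] q\<close>.
\<close>

section \<open>Additivity of the Frobenius map\<close>

context cring
begin

lemma binomial_expansion: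
  assumes a: "a \<in> carrier R" and b: "b \<in> carrier R"
  shows "(a \<oplus> b) [^] n =
    (\<Oplus>k\<in>{..n}. [(n choose k)] \<cdot> (a [^] k \<otimes> b [^] (n - k)))"
proof (induction n)
  case 0
  then show ?case by simp
next
  case (Suc n)
  let ?t = "\<lambda>k. a [^] Suc k \<otimes> b [^] (n - k)"
  let ?S = "\<Oplus>k\<in>{..n}. [(n choose k)] \<cdot> (a [^] k \<otimes> b [^] (n - k))"
  have "?S \<otimes> a = (\<Oplus>k\<in>{..n}. [(n choose k)] \<cdot> ?t k)"
    using a b
    by (subst finsum_ldistr) (auto intro!: finsum_cong' simp: add_pow_ldistr add_pow_rdistr m_ac)
  moreover have "?S \<otimes> b = (\<Oplus>k\<in>{..n}. [(n choose Suc k)] \<cdot> ?t k) \<oplus> b [^] Suc n"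
  proof -
    have "?S \<otimes> b = (\<Oplus>k\<in>{..n}. [(n choose k)] \<cdot> (a [^] k \<otimes> b [^] (Suc n - k)))"
      using a b
      by (subst finsum_ldistr)
        (auto intro!: finsum_cong' simp: add_pow_ldistr m_assoc Suc_diff_le)
    also have "\<dots> = (\<Oplus>k\<in>{..Suc n}. [(n choose k)] \<cdot> (a [^] k \<otimes> b [^] (Suc n - k)))"
      using a b by (subst finsum_Suc) (auto simp: binomial_eq_0)
    also have "\<dots> = (\<Oplus>k\<in>{..n}. [(n choose Suc k)] \<cdot> ?t k) \<oplus> b [^] Suc n"
      using a b by (subst finsum_Suc2) auto
    finally show ?thesis .
  qed
  moreover have "(a \<oplus> b) [^] Suc n = ?S \<otimes> a \<oplus> ?S \<otimes> b"
    using a b by (simp add: Suc.IH r_distr)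
  ultimately have "(a \<oplus> b) [^] Suc n =
      (\<Oplus>k\<in>{..n}. [(n choose k)] \<cdot> ?t k \<oplus> [(n choose Suc k)] \<cdot> ?t k) \<oplus> b [^] Suc n"
    using a b by (subst finsum_addf) (auto simp: a_assoc)
  also have "\<dots> = (\<Oplus>k\<in>{..n}. [(Suc n choose Suc k)] \<cdot> ?t k) \<oplus> b [^] Suc n"
    using a b by (auto intro!: arg_cong2[where f = "(\<oplus>)"] finsum_cong' simp: add.nat_pow_mult)
  also have "\<dots> = (\<Oplus>k\<in>{..Suc n}. [(Suc n choose k)] \<cdot> (a [^] k \<otimes> b [^] (Suc n - k)))"
    using a b by (subst finsum_Suc2) auto
  finally show ?case .
qed

lemma multiple_of_ring_char:
  assumes "ring_char R dvd n" and y: "y \<in> carrier R"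
  shows "[n] \<cdot> y = \<zero>"
proof -
  have one: "[ring_char R] \<cdot> \<one> = \<zero>"
    using add.pow_ord_eq_1[of \<one>] by (simp add: ring_char_def)
  obtain m where n: "n = ring_char R * m" using assms(1) by blast
  have "[n] \<cdot> \<one> = [m] \<cdot> ([ring_char R] \<cdot> \<one>)"
    using add.nat_pow_pow[of \<one> m "ring_char R"] by (simp add: n)
  hence "[n] \<cdot> \<one> = \<zero>" using one by simp
  thus ?thesis using add_pow_ldistr[of \<one> y n] y by simp
qed

text \<open>
  In the binomial expansion every term other than the two extreme ones is killed, because a
  prime \<open>p\<close> divides \<open>p choose k\<close> for \<open>0 < k < p\<close>.
\<close>

lemma frobenius_add:
  assumes p: "Factorial_Ring.prime (ring_char R)"
    and a: "a \<in> carrier R" and b: "b \<in> carrier R"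
  shows "(a \<oplus> b) [^] ring_char R = a [^] ring_char R \<oplus> b [^] ring_char R"
proof -
  let ?p = "ring_char R"
  let ?t = "\<lambda>k. [(?p choose k)] \<cdot> (a [^] k \<otimes> b [^] (?p - k))"
  have p0: "?p > 0" using p prime_gt_0_nat by blast
  have van: "?t k = \<zero>" if "k \<in> {..?p} - {0, ?p}" for k
  proof -
    have "?p dvd (?p choose k)"
      using that p by (intro dvd_choose_prime) auto
    thus ?thesis using a b by (intro multiple_of_ring_char) auto
  qed
  have "(a \<oplus> b) [^] ?p = finsum R ?t {..?p}"
    by (rule binomial_expansion[OF a b])
  also have "\<dots> = finsum R ?t {0, ?p}"
    using a b by (intro add.finprod_mono_neutral_cong_right ballI van) auto
  also have "\<dots> = a [^] ?p \<oplus> b [^] ?p"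
    using a b p0 by (simp add: a_comm)
  finally show ?thesis .
qed

lemma frobenius_power_add:
  assumes p: "Factorial_Ring.prime (ring_char R)"
    and a: "a \<in> carrier R" and b: "b \<in> carrier R"
  shows "(a \<oplus> b) [^] (ring_char R ^ e) = a [^] (ring_char R ^ e) \<oplus> b [^] (ring_char R ^ e)"
proof (induction e)
  case 0
  then show ?case using a b by simp
next
  case (Suc e)
  have pw: "y [^] (ring_char R ^ Suc e) = (y [^] (ring_char R ^ e)) [^] ring_char R"
    if "y \<in> carrier R" for y
    using that by (simp add: nat_pow_pow mult.commute)
  show ?case
    using a b Suc frobenius_add[OF p, of "a [^] (ring_char R ^ e)" "b [^] (ring_char R ^ e)"]
    by (simp only: pw a_closed nat_pow_closed)
qed

lemma frobenius_power_finsum: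
  assumes p: "Factorial_Ring.prime (ring_char R)"
    and "finite F" and "g \<in> F \<rightarrow> carrier R"
  shows "(\<Oplus>d\<in>F. g d) [^] (ring_char R ^ e) = (\<Oplus>d\<in>F. g d [^] (ring_char R ^ e))"
  using assms(2,3)
proof (induction F rule: finite_induct)
  case empty
  have "ring_char R ^ e > 0" using p prime_gt_0_nat by simp
  then show ?case by (simp add: nat_pow_zero)
next
  case (insert d F)
  then show ?case
    by (simp add: Pi_def frobenius_power_add[OF p])
qed

end

lemma (in abelian_group) additive_subgroup_finsum_closed:
  assumes H: "additive_subgroup H G" and "finite F" and "\<And>d. d \<in> F \<Longrightarrow> g d \<in> H"
  shows "(\<Oplus>d\<in>F. g d) \<in> H"
  using assms(2,3)
proof (induction F rule: finite_induct)
  case empty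
  then show ?case by (simp add: additive_subgroup.zero_closed[OF H])
next
  case (insert d F)
  moreover have "g \<in> insert d F \<rightarrow> carrier G"
    using insert.prems additive_subgroup.a_Hcarr[OF H] by blast
  ultimately show ?case
    by (auto simp: Pi_def intro!: additive_subgroup.a_closed[OF H])
qed

section \<open>Homogeneous components\<close>

context multigraded_ring
begin

definition component :: "'a \<Rightarrow> nat ^ 'n \<Rightarrow> 'a" where
  "component r = (THE g. (\<forall>d. g d \<in> A d) \<and> finite {d. g d \<noteq> \<zero>} \<and>
     r = (\<Oplus>d\<in>{d. g d \<noteq> \<zero>}. g d))"

lemma degree_part_closed: "x \<in> A d \<Longrightarrow> x \<in> carrier R"
  using additive_subgroup.a_Hcarr[OF component_subgroup] .

lemma zero_in_degree_part [simp]: "\<zero> \<in> A d"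
  using additive_subgroup.zero_closed[OF component_subgroup] .

lemma
  assumes "r \<in> carrier R"
  shows component_in_degree_part: "component r d \<in> A d"
    and finite_component_support: "finite {d. component r d \<noteq> \<zero>}"
    and sum_of_components: "(\<Oplus>d\<in>{d. component r d \<noteq> \<zero>}. component r d) = r"
  using theI'[OF direct_sum[OF assms]] unfolding component_def[symmetric] by auto

lemma component_closed [simp]: "r \<in> carrier R \<Longrightarrow> component r d \<in> carrier R"
  using component_in_degree_part degree_part_closed by blast

lemma sum_over_support:
  assumes "finite F" and "\<And>d. g d \<in> A d" and "\<And>d. d \<notin> F \<Longrightarrow> g d = \<zero>"
  shows "(\<Oplus>d\<in>{d. g d \<noteq> \<zero>}. g d) = (\<Oplus>d\<in>F. g d)"
  using assms degree_part_closed by (intro add.finprod_mono_neutral_cong_left) auto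

lemma component_unique:
  assumes "finite F" and "\<And>d. g d \<in> A d" and "\<And>d. d \<notin> F \<Longrightarrow> g d = \<zero>"
  shows "component (\<Oplus>d\<in>F. g d) = g"
proof -
  let ?r = "\<Oplus>d\<in>F. g d"
  have r: "?r \<in> carrier R" using assms degree_part_closed by (intro finsum_closed) auto
  have "finite {d. g d \<noteq> \<zero>}"
    by (rule finite_subset[OF _ assms(1)]) (use assms(3) in auto)
  with assms sum_over_support[of F g] have
    "(\<forall>d. g d \<in> A d) \<and> finite {d. g d \<noteq> \<zero>} \<and> ?r = (\<Oplus>d\<in>{d. g d \<noteq> \<zero>}. g d)" by simp
  thus ?thesis unfolding component_def by (rule the1_equality[OF direct_sum[OF r]])
qed

lemma component_add:
  assumes r: "r \<in> carrier R" and s: "s \<in> carrier R"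
  shows "component (r \<oplus> s) d = component r d \<oplus> component s d"
proof -
  let ?F = "{d. component r d \<noteq> \<zero>} \<union> {d. component s d \<noteq> \<zero>}"
  have fin: "finite ?F" using finite_component_support r s by simp
  have "(\<Oplus>d\<in>?F. component r d) = r"
    by (rule sum_over_support[OF fin component_in_degree_part[OF r], symmetric,
          unfolded sum_of_components[OF r]]) blast
  moreover have "(\<Oplus>d\<in>?F. component s d) = s"
    by (rule sum_over_support[OF fin component_in_degree_part[OF s], symmetric,
          unfolded sum_of_components[OF s]]) blast
  moreover have "(\<Oplus>d\<in>?F. component r d \<oplus> component s d) =
      (\<Oplus>d\<in>?F. component r d) \<oplus> (\<Oplus>d\<in>?F. component s d)"
    using r s by (intro finsum_addf) (simp_all add: Pi_def)
  ultimately have sum: "(\<Oplus>d\<in>?F. component r d \<oplus> component s d) = r \<oplus> s"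
    by (simp only:)
  have "component (\<Oplus>d\<in>?F. component r d \<oplus> component s d) =
      (\<lambda>d. component r d \<oplus> component s d)"
  proof (rule component_unique[OF fin])
    show "component r d \<oplus> component s d \<in> A d" for d
      by (intro additive_subgroup.a_closed[OF component_subgroup] component_in_degree_part r s)
    show "component r d \<oplus> component s d = \<zero>" if "d \<notin> ?F" for d
      using that by simp
  qed
  thus ?thesis by (simp only: sum)
qed

lemma component_of_homogeneous:
  assumes "x \<in> A d"
  shows "component x e = (if e = d then x else \<zero>)"
proof -
  let ?g = "\<lambda>e. if e = d then x else \<zero>"
  have "component (\<Oplus>e\<in>{d}. ?g e) = ?g"
    using assms by (intro component_unique) auto
  moreover have "(\<Oplus>e\<in>{d}. ?g e) = x"
    using degree_part_closed[OF assms] by simp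
  ultimately show ?thesis by simp
qed

lemma component_zero [simp]: "component \<zero> d = \<zero>"
  using component_of_homogeneous[of \<zero> d d] by simp

lemma component_uminus:
  assumes "r \<in> carrier R"
  shows "component (\<ominus> r) d = \<ominus> component r d"
  using component_add[of "\<ominus> r" r d] assms minus_equality[of "component (\<ominus> r) d" "component r d"] by (simp add: l_neg)

section \<open>Subgroups described degree by degree\<close>

text \<open>
  The subgroups \<open>B d\<close> are not required to lie in \<open>A d\<close>. A constant family \<open>\<lambda>_. J\<close> thus gives
  the elements all of whose components are in \<open>J\<close>, and an ideal \<open>J\<close> is homogeneous exactly when
  it equals this set; families that are \<open>A d\<close> or zero express bounds on degrees.
\<close>

definition graded_span :: "(nat ^ 'n \<Rightarrow> 'a set) \<Rightarrow> 'a set" where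
  "graded_span B = {r \<in> carrier R. \<forall>d. component r d \<in> B d}"

lemma graded_span_additive_subgroup:
  assumes "\<And>d. additive_subgroup (B d) R"
  shows "additive_subgroup (graded_span B) R"
proof (rule additive_subgroupI, rule add.subgroupI)
  show "graded_span B \<subseteq> carrier R" by (auto simp: graded_span_def)
  have "\<zero> \<in> graded_span B"
    using additive_subgroup.zero_closed[OF assms] by (simp add: graded_span_def)
  thus "graded_span B \<noteq> {}" by blast
  show "\<ominus> r \<in> graded_span B" if "r \<in> graded_span B" for r
    using that additive_subgroup.a_inv_closed[OF assms]
    by (simp add: graded_span_def component_uminus)
  show "r \<oplus> s \<in> graded_span B" if "r \<in> graded_span B" "s \<in> graded_span B" for r s
    using that additive_subgroup.a_closed[OF assms]
    by (simp add: graded_span_def component_add)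
qed

lemma homogeneous_in_graded_span:
  assumes "x \<in> A d" and "x \<in> B d" and "\<And>e. \<zero> \<in> B e"
  shows "x \<in> graded_span B"
  using assms by (auto simp: graded_span_def component_of_homogeneous degree_part_closed)

text \<open>
  Expanding both factors into components writes the product as a sum of homogeneous products,
  each of which lies in a single degree and is covered by the hypothesis on \<open>B\<close>, \<open>C\<close> and \<open>D\<close>.
\<close>

lemma graded_span_mult:
  assumes D: "\<And>d. additive_subgroup (D d) R"
    and BCD: "\<And>e f y z. \<lbrakk> y \<in> B e; z \<in> C f; y \<in> A e; z \<in> A f \<rbrakk> \<Longrightarrow> y \<otimes> z \<in> D (e + f)"
    and r: "r \<in> graded_span B" and t: "t \<in> graded_span C"
  shows "r \<otimes> t \<in> graded_span D"
proof -
  have rc: "r \<in> carrier R" and tc: "t \<in> carrier R"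
    using r t by (auto simp: graded_span_def)
  note sub = additive_subgroup_finsum_closed[OF graded_span_additive_subgroup[OF D]]
  let ?F = "{d. component r d \<noteq> \<zero>}" and ?G = "{d. component t d \<noteq> \<zero>}"
  have "component r e \<otimes> component t f \<in> graded_span D" for e f
    using rc tc r t
    by (intro homogeneous_in_graded_span[of _ "e + f"] component_mult BCD
        component_in_degree_part additive_subgroup.zero_closed[OF D])
      (auto simp: graded_span_def)
  hence "(\<Oplus>e\<in>?F. \<Oplus>f\<in>?G. component r e \<otimes> component t f) \<in> graded_span D"
    using rc tc by (intro sub finite_component_support)
  moreover have "(\<Oplus>e\<in>?F. \<Oplus>f\<in>?G. component r e \<otimes> component t f) = r \<otimes> t"
  proof -
    have "(\<Oplus>e\<in>?F. \<Oplus>f\<in>?G. component r e \<otimes> component t f) = (\<Oplus>e\<in>?F. component r e \<otimes> t)"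
      using rc tc
      by (intro finsum_cong')
        (auto simp: finsum_rdistr[symmetric] finite_component_support sum_of_components)
    also have "\<dots> = r \<otimes> t"
      using rc tc
      by (auto simp: finsum_ldistr[symmetric] finite_component_support sum_of_components)
    finally show ?thesis .
  qed
  ultimately show ?thesis by simp
qed

lemma graded_span_whole: "graded_span A = carrier R"
  by (auto simp: graded_span_def component_in_degree_part)

lemma ideal_graded_span:
  assumes J: "ideal J R"
  shows "ideal (graded_span (\<lambda>_. J)) R"
proof (rule idealI)
  interpret J: ideal J R by (rule J)
  have sub: "additive_subgroup J R" by (rule J.additive_subgroup_axioms)
  show "ring R" by (rule ring_axioms)
  show "subgroup (graded_span (\<lambda>_. J)) (add_monoid R)"
    using graded_span_additive_subgroup[OF sub] by (rule additive_subgroup.a_subgroup)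
  show "y \<otimes> r \<in> graded_span (\<lambda>_. J)" if "r \<in> graded_span (\<lambda>_. J)" "y \<in> carrier R" for r y
    using that graded_span_whole
    by (intro graded_span_mult[of "\<lambda>_. J" A "\<lambda>_. J" y r] sub)
      (auto intro: J.I_l_closed degree_part_closed)
  show "r \<otimes> y \<in> graded_span (\<lambda>_. J)" if "r \<in> graded_span (\<lambda>_. J)" "y \<in> carrier R" for r y
    using that graded_span_whole
    by (intro graded_span_mult[of "\<lambda>_. J" "\<lambda>_. J" A r y] sub)
      (auto intro: J.I_r_closed degree_part_closed)
qed

lemma graded_span_of_ideal_subset:
  assumes J: "ideal J R"
  shows "graded_span (\<lambda>_. J) \<subseteq> J"
proof
  fix r assume r: "r \<in> graded_span (\<lambda>_. J)"
  hence rc: "r \<in> carrier R" by (simp add: graded_span_def)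
  have "(\<Oplus>d\<in>{d. component r d \<noteq> \<zero>}. component r d) \<in> J"
    using r rc finite_component_support J
    by (intro additive_subgroup_finsum_closed) (auto simp: graded_span_def ideal.axioms(1))
  thus "r \<in> J" using rc by (simp add: sum_of_components)
qed

text \<open>
  The right-hand side is an ideal by \<open>ideal_graded_span\<close>, so it is enough that it contains the
  homogeneous generators of \<open>I\<close>.
\<close>

lemma homogeneous_ideal_subset_graded_span:
  assumes "homogeneous_ideal R A I"
  shows "I \<subseteq> graded_span (\<lambda>_. I)"
proof -
  from assms obtain S where I: "ideal I R" and S: "S \<subseteq> (\<Union>d. A d)" "I = Idl S"
    unfolding homogeneous_ideal_def by blast
  have "S \<subseteq> I" using S degree_part_closed genideal_self[of S] by blast
  have "S \<subseteq> graded_span (\<lambda>_. I)"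
  proof
    fix x assume x: "x \<in> S"
    then obtain d where "x \<in> A d" using S by blast
    thus "x \<in> graded_span (\<lambda>_. I)"
      using x \<open>S \<subseteq> I\<close> additive_subgroup.zero_closed[OF ideal.axioms(1)[OF I]]
      by (intro homogeneous_in_graded_span) auto
  qed
  thus ?thesis using genideal_minimal[OF ideal_graded_span[OF I]] S by simp
qed

section \<open>Homogeneity of Frobenius powers\<close>

text \<open>
  The exponent has to be positive since the unit element is not known at this point to have
  degree zero.
\<close>

lemma homogeneous_pow:
  assumes "x \<in> A d" and "n > 0"
  shows "x [^] n \<in> A (\<chi> i. n * d $ i)"
  using assms(2)
proof (induction n rule: nat_induct_non_zero)
  case 1
  then show ?case using assms(1) degree_part_closed by simp
next
  case (Suc n)
  have "(\<chi> i. Suc n * d $ i) = (\<chi> i. n * d $ i) + d" by (simp add: vec_eq_iff)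
  then show ?case using component_mult[OF Suc.IH assms(1)] by simp
qed

lemma frobenius_power_ideal:
  assumes "I \<subseteq> carrier R"
  shows "ideal (frobenius_power R I q) R"
  unfolding frobenius_power_def using assms by (intro genideal_ideal) auto

text \<open>
  For \<open>f\<close> in \<open>I\<close> with components \<open>f\<^sub>d\<close>, additivity of Frobenius gives \<open>f [^] q\<close> as the sum of the
  homogeneous elements \<open>f\<^sub>d [^] q\<close>. Each \<open>f\<^sub>d\<close> is in \<open>I\<close>, so these summands are in the Frobenius
  power; hence all generators of the Frobenius power have their components in it.
\<close>

lemma frobenius_power_subset_graded_span:
  assumes p: "Factorial_Ring.prime (ring_char R)" and I: "homogeneous_ideal R A I"
    and q: "q = ring_char R ^ e"
  shows "frobenius_power R I q \<subseteq> graded_span (\<lambda>_. frobenius_power R I q)"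
proof -
  let ?J = "frobenius_power R I q"
  have Ic: "I \<subseteq> carrier R"
    using I ideal.Icarr by (auto simp: homogeneous_ideal_def)
  have J: "ideal ?J R" by (rule frobenius_power_ideal[OF Ic])
  have sub: "additive_subgroup ?J R" by (rule ideal.axioms(1)[OF J])
  have q0: "q > 0" using p prime_gt_0_nat by (simp add: q)
  have gen: "f [^] q \<in> ?J" if "f \<in> I" for f
  proof -
    have "(\<lambda>f. f [^] q) ` I \<subseteq> ?J"
      unfolding frobenius_power_def using Ic by (intro genideal_self) auto
    thus ?thesis using that by blast
  qed
  have "f [^] q \<in> graded_span (\<lambda>_. ?J)" if f: "f \<in> I" for f
  proof -
    have fc: "f \<in> carrier R" using f Ic by blast
    let ?F = "{d. component f d \<noteq> \<zero>}"
    have fin: "finite ?F" by (rule finite_component_support[OF fc])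
    have comp: "component f d \<in> I" for d
      using homogeneous_ideal_subset_graded_span[OF I] f by (auto simp: graded_span_def)
    have homog: "component f d [^] q \<in> graded_span (\<lambda>_. ?J)" for d
      using homogeneous_pow[OF component_in_degree_part[OF fc] q0] gen[OF comp]
        additive_subgroup.zero_closed[OF sub]
      by (rule homogeneous_in_graded_span)
    have "f [^] q = (\<Oplus>d\<in>?F. component f d [^] q)"
      using frobenius_power_finsum[OF p fin, of "component f" e] fc
      by (simp add: q sum_of_components)
    also have "\<dots> \<in> graded_span (\<lambda>_. ?J)"
      by (intro additive_subgroup_finsum_closed graded_span_additive_subgroup sub fin homog)
    finally show ?thesis .
  qed
  hence "(\<lambda>f. f [^] q) ` I \<subseteq> graded_span (\<lambda>_. ?J)" by blast
  from genideal_minimal[OF ideal_graded_span[OF J] this]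
  show ?thesis by (simp add: frobenius_power_def)
qed

section \<open>Degree bounds\<close>

definition degree_restricted :: "(nat ^ 'n \<Rightarrow> bool) \<Rightarrow> nat ^ 'n \<Rightarrow> 'a set" where
  "degree_restricted P d = (if P d then A d else {\<zero>})"

lemma degree_restricted_additive_subgroup: "additive_subgroup (degree_restricted P d) R"
  using component_subgroup zeroideal ideal.axioms(1) by (auto simp: degree_restricted_def)

lemma zero_in_degree_restricted [simp]: "\<zero> \<in> degree_restricted P d"
  by (simp add: degree_restricted_def)

lemma degree_restricted_mult:
  assumes "\<And>e f. \<lbrakk> P e; Q f \<rbrakk> \<Longrightarrow> T (e + f)"
    and "r \<in> graded_span (degree_restricted P)" and "t \<in> graded_span (degree_restricted Q)"
  shows "r \<otimes> t \<in> graded_span (degree_restricted T)"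
  using assms(2,3)
proof (rule graded_span_mult[OF degree_restricted_additive_subgroup, rotated])
  fix e f y z
  assume "y \<in> degree_restricted P e" "z \<in> degree_restricted Q f" "y \<in> A e" "z \<in> A f"
  thus "y \<otimes> z \<in> degree_restricted T (e + f)"
    using assms(1)[of e f] degree_part_closed
    by (auto simp: degree_restricted_def component_mult split: if_splits)
qed

lemma ideal_power_degree_bound:
  assumes I: "ideal I R" and bound: "I \<subseteq> graded_span (degree_restricted (\<lambda>e. k \<le> e $ i))"
  shows "I [^]\<^bsub>ideals_set R\<^esub> (n::nat) \<subseteq> graded_span (degree_restricted (\<lambda>e. n * k \<le> e $ i))"
proof (induction n)
  case 0
  have "degree_restricted (\<lambda>e. 0 * k \<le> e $ i) = A"
    by (simp add: fun_eq_iff degree_restricted_def)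
  then show ?case by (simp add: ideals_set_def graded_span_whole nat_pow_def)
next
  case (Suc n)
  let ?K = "graded_span (degree_restricted (\<lambda>e. Suc n * k \<le> e $ i))"
  have "y \<in> ?K" if "y \<in> (I [^]\<^bsub>ideals_set R\<^esub> n) \<cdot> I" for y
    using that
  proof (induction rule: ideal_prod.induct)
    case (prod a b)
    with Suc.IH bound show ?case
      by (intro degree_restricted_mult[of "\<lambda>e. n * k \<le> e $ i" "\<lambda>e. k \<le> e $ i"]) auto
  next
    case (sum a b)
    then show ?case
      by (intro additive_subgroup.a_closed[OF graded_span_additive_subgroup[OF
              degree_restricted_additive_subgroup]])
  qed
  moreover have "I [^]\<^bsub>ideals_set R\<^esub> Suc n = (I [^]\<^bsub>ideals_set R\<^esub> n) \<cdot> I"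
    by (simp add: nat_pow_def ideals_set_def)
  ultimately show ?case by blast
qed

text \<open>
  A nonzero component of an element of \<open>I\<close> is itself a nonzero homogeneous element of \<open>I\<close>, so it
  competes in the minimum that defines \<open>min_degree\<close>. If \<open>I\<close> is zero there is no such component,
  and the bound holds whatever value \<open>min_degree\<close> takes.
\<close>

lemma homogeneous_ideal_min_degree:
  assumes I: "homogeneous_ideal R A I"
  shows "I \<subseteq> graded_span (degree_restricted (\<lambda>e. min_degree R A I $ i \<le> e $ i))"
proof
  fix f assume f: "f \<in> I"
  have span: "f \<in> graded_span (\<lambda>_. I)"
    using homogeneous_ideal_subset_graded_span[OF I] f by blast
  hence fc: "f \<in> carrier R" by (simp add: graded_span_def)
  have "component f e \<in> degree_restricted (\<lambda>e. min_degree R A I $ i \<le> e $ i) e" for e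
  proof (cases "component f e = \<zero>")
    case False
    have "component f e \<in> A e" using fc by (rule component_in_degree_part)
    moreover have "component f e \<in> I" using span by (simp add: graded_span_def)
    ultimately have "min_degree R A I $ i \<le> e $ i"
      using False unfolding min_degree_def by (auto intro!: Least_le)
    thus ?thesis using \<open>component f e \<in> A e\<close> by (simp add: degree_restricted_def)
  qed simp
  thus "f \<in> graded_span (degree_restricted (\<lambda>e. min_degree R A I $ i \<le> e $ i))"
    using fc by (simp add: graded_span_def)
qed

lemma component_degree_bound:
  assumes "c \<in> carrier R"
  obtains D where "c \<in> graded_span (degree_restricted (\<lambda>e. e $ i \<le> D))"
proof
  let ?S = "(\<lambda>e. e $ i) ` {e. component c e \<noteq> \<zero>}"
  have "e $ i \<le> Max ?S" if "component c e \<noteq> \<zero>" for e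
    using that finite_component_support[OF assms] by (intro Max_ge) auto
  thus "c \<in> graded_span (degree_restricted (\<lambda>e. e $ i \<le> Max ?S))"
    using assms component_in_degree_part
    by (auto simp: graded_span_def degree_restricted_def)
qed

section \<open>Low degree elements of the weak closure\<close>

text \<open>
  The ordinary power of \<open>I\<close> lives in degrees above the bound \<open>m\<close> on the degrees of \<open>y\<close>, so it
  cannot contribute to the components of \<open>y\<close> there; in the remaining degrees \<open>y\<close> has no components.
\<close>

lemma mixed_power_low_degree:
  assumes p: "Factorial_Ring.prime (ring_char R)" and I: "homogeneous_ideal R A I"
    and q: "q = ring_char R ^ e"
    and y: "y \<in> mixed_power R I s q" "y \<in> graded_span (degree_restricted (\<lambda>f. f $ i \<le> m))"
    and m: "m < nat \<lceil>s * real q\<rceil> * min_degree R A I $ i"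
  shows "y \<in> frobenius_power R I q"
proof -
  let ?J = "frobenius_power R I q" and ?N = "nat \<lceil>s * real q\<rceil>"
  have Ii: "ideal I R" using I by (simp add: homogeneous_ideal_def)
  have J: "ideal ?J R"
    using ideal.Icarr[OF Ii] by (intro frobenius_power_ideal) auto
  obtain u v where u: "u \<in> I [^]\<^bsub>ideals_set R\<^esub> ?N" and v: "v \<in> ?J" and yuv: "y = u \<oplus> v"
    using y(1) unfolding mixed_power_def set_add_defs by auto
  have u': "u \<in> graded_span (degree_restricted (\<lambda>f. ?N * min_degree R A I $ i \<le> f $ i))"
    using ideal_power_degree_bound[OF Ii homogeneous_ideal_min_degree[OF I]] u by blast
  have v': "v \<in> graded_span (\<lambda>_. ?J)"
    using frobenius_power_subset_graded_span[OF p I q] v by blast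
  have uc: "u \<in> carrier R" and vc: "v \<in> carrier R"
    using u' v' by (auto simp: graded_span_def)
  have "component y f \<in> ?J" for f
  proof (cases "f $ i \<le> m")
    case True
    hence "\<not> ?N * min_degree R A I $ i \<le> f $ i" using m by linarith
    moreover have "component u f \<in> degree_restricted (\<lambda>f. ?N * min_degree R A I $ i \<le> f $ i) f"
      using u' by (simp add: graded_span_def)
    ultimately have "component u f = \<zero>" by (simp add: degree_restricted_def)
    hence "component y f = component v f" using uc vc yuv by (simp add: component_add)
    thus ?thesis using v' by (simp add: graded_span_def)
  next
    case False
    moreover have "component y f \<in> degree_restricted (\<lambda>f. f $ i \<le> m) f"
      using y(2) by (simp add: graded_span_def)
    ultimately have "component y f = \<zero>" by (simp add: degree_restricted_def)
    thus ?thesis using additive_subgroup.zero_closed[OF ideal.axioms(1)[OF J]] by simp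
  qed
  hence "y \<in> graded_span (\<lambda>_. ?J)" using y(2) by (simp add: graded_span_def)
  thus ?thesis using graded_span_of_ideal_subset[OF J] by blast
qed

text \<open>
  The same \<open>c\<close> works for both closures: its degrees are bounded independently of \<open>q\<close>, while the
  gap between \<open>q * d $ i\<close> and \<open>s * q * \<delta> $ i\<close> grows linearly with \<open>q\<close>.
\<close>

lemma low_degree_in_tight_closure:
  assumes p: "Factorial_Ring.prime (ring_char R)" and I: "homogeneous_ideal R A I"
    and x: "x \<in> weak_closure R s I" "x \<in> A d"
    and low: "real (d $ i) < s * real (min_degree R A I $ i)"
  shows "x \<in> tight_closure R I"
proof -
  let ?p = "ring_char R" and ?k = "min_degree R A I $ i"
  from x(1) obtain c where c: "c \<in> off_minimal_primes R"
    and ev: "\<forall>\<^sub>F e in sequentially. c \<otimes> x [^] (?p ^ e) \<in> mixed_power R I s (?p ^ e)"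
    unfolding weak_closure_def by (auto simp: Let_def)
  have cc: "c \<in> carrier R" and xc: "x \<in> carrier R"
    using c x by (auto simp: off_minimal_primes_def weak_closure_def)
  obtain D where D: "c \<in> graded_span (degree_restricted (\<lambda>f. f $ i \<le> D))"
    using component_degree_bound[OF cc] .
  let ?gap = "s * real ?k - real (d $ i)"
  have gap: "?gap > 0" using low by simp
  \<comment> \<open>This bound on \<open>q\<close> amounts to \<open>D + q * d $ i < s * q * \<delta> $ i\<close>.\<close>
  have big: "\<forall>\<^sub>F e in sequentially. real ?p ^ e > real D / ?gap"
  proof -
    have p1: "real ?p > 1" using prime_gt_1_nat[OF p] by simp
    obtain n where n: "real D / ?gap < real ?p ^ n" using real_arch_pow[OF p1] by blast
    have "real D / ?gap < real ?p ^ e" if "e \<ge> n" for e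
      using n power_increasing[OF that, of "real ?p"] p1 by linarith
    thus ?thesis unfolding eventually_sequentially by blast
  qed
  have "\<forall>\<^sub>F e in sequentially. c \<otimes> x [^] (?p ^ e) \<in> frobenius_power R I (?p ^ e)"
    using ev big
  proof eventually_elim
    case (elim e)
    let ?q = "?p ^ e"
    have q0: "?q > 0" using prime_gt_0_nat[OF p] by simp
    have "x [^] ?q \<in> graded_span (degree_restricted (\<lambda>f. f $ i \<le> ?q * d $ i))"
      using homogeneous_pow[OF x(2) q0]
      by (intro homogeneous_in_graded_span) (auto simp: degree_restricted_def)
    from degree_restricted_mult[OF _ D this, of "\<lambda>f. f $ i \<le> D + ?q * d $ i"]
    have span: "c \<otimes> x [^] ?q \<in> graded_span (degree_restricted (\<lambda>f. f $ i \<le> D + ?q * d $ i))"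
      by (simp add: add_mono)
    have "real (D + ?q * d $ i) < s * real ?q * real ?k"
      using elim(2) gap by (simp add: field_simps)
    also have "\<dots> \<le> real (nat \<lceil>s * real ?q\<rceil>) * real ?k"
      by (intro mult_right_mono real_nat_ceiling_ge) auto
    finally have "D + ?q * d $ i < nat \<lceil>s * real ?q\<rceil> * ?k"
      unfolding of_nat_mult[symmetric] of_nat_less_iff .
    from mixed_power_low_degree[OF p I refl elim(1) span this] show ?case .
  qed
  thus ?thesis using c xc unfolding tight_closure_def by (auto simp: Let_def)
qed

end

theorem theorem3p2:
  fixes R :: "('a, 'm) ring_scheme"
    and A :: "nat ^ ('n::finite) \<Rightarrow> 'a set"
    and I :: "'a set" and s :: real and x :: 'a and d :: "nat ^ 'n"
  assumes "noetherian_ring R"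
    and "multigraded_ring R A"
    and "Factorial_Ring.prime (ring_char R)"
    and "homogeneous_ideal R A I"
    and "s \<ge> 1"
    and "x \<in> weak_closure R s I - tight_closure R I"
    and "x \<in> A d"
  shows "\<forall>i. real (d $ i) \<ge> s * real (min_degree R A I $ i)"
proof
  fix i
  interpret multigraded_ring R A by (rule assms(2))
  show "real (d $ i) \<ge> s * real (min_degree R A I $ i)"
    using low_degree_in_tight_closure[OF assms(3,4) _ assms(7)] assms(6)
    by (meson DiffD1 DiffD2 not_le)
qed

end
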